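(* Let $F : ([0,1]^{<\omega})^m \to [0,1]$ be an aggregation function, where $m \in \mathbb{N}^+$. (i) If, for some $k_1, \ldots, k_m \in \mathbb{N}^+$, $F$ is up-continuous with respect to the parameters $c_{i,j}, \alpha_{i,j} \in [0,1]$, $i = 1, \ldots, m$, $j = 1, \ldots, k_i$, then $F$ is ct-continuous with respect to the same parameters $c_{i,j}, \alpha_{i,j}$. (ii) Let $k_1, \ldots, k_m \in \mathbb{N}^+$ and $c_{i,j}, \alpha_{i,j} \in [0,1]$ for $i = 1, \ldots, m$ and $j = 1, \ldots, k_i$. If there is $\delta > 0$ such that, for all $\alpha'_{i,j} \in (\alpha_{i,j} - \delta, \alpha_{i,j} + \delta) \cap [0,1]$, $i = 1, \ldots, m$, $j = 1, \ldots, k_i$, $F$ is ct-continuous with respect to the parameters $c_{i,j}, \alpha'_{i,j}$, $i = 1, \ldots, m$, $j = 1, \ldots, k_i$, then $F$ is up-continuous with respect to the parameters $c_{i,j}, \alpha_{i,j}$, $i = 1, \ldots, m$, $j = 1, \ldots, k_i$.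
   Context: $\mathbb{N}$ and $\mathbb{N}^+$ are the sets of nonnegative, respectively positive, integers. $[0,1]^{<\omega} = \bigcup_{n \ge 1} [0,1]^n$; $|\bar{p}|$ is the length of $\bar{p}$ and $\mathrm{rng}(\bar{p})$ its set of entries. An ($m$-ary) aggregation function is a function $F : ([0,1]^{<\omega})^m \to [0,1]$ whose value does not change when the entries within each argument $\bar{p}_i$ are reordered. **Convergence testing sequences.** A sequence $\bar{p}_n \in [0,1]^{<\omega}$, $n \in \mathbb{N}$, with $i$th entry of $\bar{p}_n$ denoted $p_{n,i}$, is convergence testing for parameters $c_1, \ldots, c_k \in [0,1]$ and $\alpha_1, \ldots, \alpha_k \in [0,1]$ if: (1) $|\bar{p}_n| < |\bar{p}_{n+1}|$ for all $n \in \mathbb{N}$; (2) for every disjoint family of intervals $I_1, \ldots, I_k \subseteq [0,1]$, open in the induced topology on $[0,1]$, such that $c_j \in I_j$ for each $j$, there is $N \in \mathbb{N}$ such that $\mathrm{rng}(\bar{p}_n) \subseteq \bigcup_{j=1}^k I_j$ for all $n \ge N$, and for every $j \in \{1, \ldots, k\}$, $\lim_{n\to\infty} |\{i : p_{n,i} \in I_j\}| / |\bar{p}_n| = \alpha_j$. A sequence of $m$-tuples $(\bar{p}_{1,n}, \ldots, \bar{p}_{m,n}) \in ([0,1]^{<\omega})^m$, $n \in \mathbb{N}$, is convergence testing for parameters $c_{i,j}, \alpha_{i,j} \in [0,1]$ ($i = 1, \ldots, m$, $j = 1, \ldots, k_i$) if for each fixed $i$ the sequence $\bar{p}_{i,n}$,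 $n \in \mathbb{N}$, is convergence testing for $c_{i,1}, \ldots, c_{i,k_i}$ and $\alpha_{i,1}, \ldots, \alpha_{i,k_i}$. **ct-continuity.** $F$ is ct-continuous with respect to parameters $c_{i,j}, \alpha_{i,j} \in [0,1]$ ($i = 1, \ldots, m$, $j = 1, \ldots, k_i$) if for all sequences of $m$-tuples $(\bar{p}_{1,n}, \ldots, \bar{p}_{m,n})$ and $(\bar{q}_{1,n}, \ldots, \bar{q}_{m,n})$, $n \in \mathbb{N}$, that are both convergence testing for these parameters, $\lim_{n\to\infty} |F(\bar{p}_{1,n}, \ldots, \bar{p}_{m,n}) - F(\bar{q}_{1,n}, \ldots, \bar{q}_{m,n})| = 0$. **Functional representations and pseudometrics.** For $\bar{p} = (p_1, \ldots, p_n)$ let $\mathfrak{f}_{\bar{p}} : [0,1] \to [0,1]$ be given by $\mathfrak{f}_{\bar{p}}(a) = p_{i+1}$ for $a \in [i/n, (i+1)/n)$, $i = 0, \ldots, n-1$, and $\mathfrak{f}_{\bar{p}}(1) = p_n$. Let $\mathfrak{g}_{\bar{p}} = \mathfrak{f}_{\bar{p}'}$, where $\bar{p}'$ is the reordering of $\bar{p}$ in nondecreasing order. For $\bar{p}, \bar{q} \in [0,1]^{<\omega}$ let $\mu_1^u(\bar{p}, \bar{q}) = \int_{[0,1]} |\mathfrak{g}_{\bar{p}}(x) - \mathfrak{g}_{\bar{q}}(x)|\,dx$ and $\mu_\infty^o(\bar{p}, \bar{q}) = \sup_{a \in [0,1]} |\mathfrak{f}_{\bar{p}}(a) - \mathfrak{f}_{\bar{q}}(a)|$.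 On $m$-tuples, $\mu_1^u((\bar{p}_1, \ldots, \bar{p}_m), (\bar{q}_1, \ldots, \bar{q}_m)) = \max_i \mu_1^u(\bar{p}_i, \bar{q}_i)$. **Asymptotic uniform continuity.** $F$ is asymptotically uniformly continuous on $X \subseteq ([0,1]^{<\omega})^m$ if for every $\varepsilon > 0$ there are $n$ and $\delta > 0$ such that if $(\bar{p}_1, \ldots, \bar{p}_m), (\bar{q}_1, \ldots, \bar{q}_m) \in X$, $|\bar{p}_i|, |\bar{q}_i| \ge n$ for all $i$, and $\mu_1^u((\bar{p}_1, \ldots, \bar{p}_m), (\bar{q}_1, \ldots, \bar{q}_m)) < \delta$, then $|F(\bar{p}_1, \ldots, \bar{p}_m) - F(\bar{q}_1, \ldots, \bar{q}_m)| < \varepsilon$. **up-continuity.** $F$ is up-continuous with respect to parameters $c_{i,j}, \alpha_{i,j} \in [0,1]$ ($i = 1, \ldots, m$, $j = 1, \ldots, k_i$) if both of the following hold. (1) For all sufficiently small $\delta > 0$, $F$ is asymptotically uniformly continuous on $X_1 \times \cdots \times X_m$, where $X_i$ is the set of all $\bar{p} \in [0,1]^{<\omega}$ such that $\mathrm{rng}(\bar{p}) \subseteq \{c_{i,1}, \ldots, c_{i,k_i}\}$ and, for each $j = 1, \ldots, k_i$, the number of coordinates of $\bar{p}$ equal to $c_{i,j}$ is between $(\alpha_{i,j} - \delta)|\bar{p}|$ and $(\alpha_{i,j} + \delta)|\bar{p}|$. (2) For all $\varepsilon > 0$ there are $\delta > 0$ and $n_0$ such that if, for $i = 1, \ldots,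 m$, $\bar{p}_i, \bar{q}_i \in [0,1]^{<\omega}$ satisfy (a) $|\bar{p}_i| = |\bar{q}_i| > n_0$, (b) $\mu_\infty^o(\bar{p}_i, \bar{q}_i) < \delta$, (c) $\mathrm{rng}(\bar{p}_i) \subseteq \{c_{i,1}, \ldots, c_{i,k_i}\}$, and (d) for each $j = 1, \ldots, k_i$ the number of coordinates of $\bar{p}_i$ equal to $c_{i,j}$ is between $(\alpha_{i,j} - \delta)|\bar{p}_i|$ and $(\alpha_{i,j} + \delta)|\bar{p}_i|$, then $|F(\bar{p}_1, \ldots, \bar{p}_m) - F(\bar{q}_1, \ldots, \bar{q}_m)| < \varepsilon$.
   Formalization: In part (i) it is additionally assumed that, for each i, the numbers c_{i,1},…,c_{i,k_i} are pairwise distinct; with repeated c_{i,j} no disjoint intervals exist, every length-increasing sequence is convergence testing, and (i) fails (e.g. for the arithmetic mean). *)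

theory Defs
  imports "HOL-Analysis.Analysis" "HOL-Library.Multiset" "HOL-Library.Disjoint_Sets"
begin

definition unit_seqs :: "real list set" where
  "unit_seqs = {p. p \<noteq> [] \<and> set p \<subseteq> {0..1}}"

(* An m-tuple of sequences is a function 'm \<Rightarrow> real list on a finite type 'm with m elements
   (finite types are nonempty, so m > 0).  Only the values of F on tuples with all components in
   unit_seqs are meaningful; every definition below quantifies over such tuples only. *)

definition aggregation_function :: "(('m::finite \<Rightarrow> real list) \<Rightarrow> real) \<Rightarrow> bool" where
  "aggregation_function F \<longleftrightarrow>
     (\<forall>p. (\<forall>i. p i \<in> unit_seqs) \<longrightarrow> F p \<in> {0..1}) \<and>
     (\<forall>p q. (\<forall>i. p i \<in> unit_seqs) \<longrightarrow> (\<forall>i. q i \<in> unit_seqs) \<longrightarrow>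
        (\<forall>i. mset (p i) = mset (q i)) \<longrightarrow> F p = F q)"

(* The parameters c_1, ..., c_k and alpha_1, ..., alpha_k are the values of c and \<alpha> on {1..k};
   the values elsewhere play no role.  Pairwise disjoint I_1, ..., I_k with c_j in I_j exist only
   if the c_j are distinct; otherwise the last clause of convergence_testing is vacuous. *)

definition convergence_testing ::
    "nat \<Rightarrow> (nat \<Rightarrow> real) \<Rightarrow> (nat \<Rightarrow> real) \<Rightarrow> (nat \<Rightarrow> real list) \<Rightarrow> bool" where
  "convergence_testing k c \<alpha> p \<longleftrightarrow>
     (\<forall>n. p n \<in> unit_seqs) \<and>
     (\<forall>n. length (p n) < length (p (Suc n))) \<and>
     (\<forall>I :: nat \<Rightarrow> real set.
        (\<forall>j\<in>{1..k}. is_interval (I j) \<and> openin (top_of_set {0..1}) (I j) \<and> c j \<in> I j) \<longrightarrow>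
        disjoint_family_on I {1..k} \<longrightarrow>
          (\<exists>N. \<forall>n\<ge>N. set (p n) \<subseteq> (\<Union>j\<in>{1..k}. I j)) \<and>
          (\<forall>j\<in>{1..k}.
             (\<lambda>n. real (card {i. i < length (p n) \<and> p n ! i \<in> I j}) / real (length (p n)))
               \<longlonglongrightarrow> \<alpha> j))"

definition convergence_testing_tuple ::
    "('m::finite \<Rightarrow> nat) \<Rightarrow> ('m \<Rightarrow> nat \<Rightarrow> real) \<Rightarrow> ('m \<Rightarrow> nat \<Rightarrow> real) \<Rightarrow>
     (nat \<Rightarrow> 'm \<Rightarrow> real list) \<Rightarrow> bool" where
  "convergence_testing_tuple k c \<alpha> p \<longleftrightarrow>
     (\<forall>i. convergence_testing (k i) (c i) (\<alpha> i) (\<lambda>n. p n i))"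

definition ct_continuous ::
    "(('m::finite \<Rightarrow> real list) \<Rightarrow> real) \<Rightarrow>
     ('m \<Rightarrow> nat) \<Rightarrow> ('m \<Rightarrow> nat \<Rightarrow> real) \<Rightarrow> ('m \<Rightarrow> nat \<Rightarrow> real) \<Rightarrow> bool" where
  "ct_continuous F k c \<alpha> \<longleftrightarrow>
     (\<forall>p q. convergence_testing_tuple k c \<alpha> p \<longrightarrow> convergence_testing_tuple k c \<alpha> q \<longrightarrow>
        (\<lambda>n. \<bar>F (p n) - F (q n)\<bar>) \<longlonglongrightarrow> 0)"

(* Used only for a in [0,1].  Lists are indexed from 0, so the (i+1)st entry is p ! i. *)
definition func_rep :: "real list \<Rightarrow> real \<Rightarrow> real" where
  "func_rep p a = (if a = 1 then last p else p ! nat \<lfloor>a * real (length p)\<rfloor>)"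

lemma func_rep_eq:
  assumes "i < length p"
    and "a \<in> {real i / real (length p)..<real (i + 1) / real (length p)}"
  shows "func_rep p a = p ! i"
proof -
  have n: "real (length p) > 0" using assms(1) by auto
  have lo: "real i \<le> a * real (length p)" and hi: "a * real (length p) < real i + 1"
    using assms(2) n by (auto simp: field_simps)
  have "\<lfloor>a * real (length p)\<rfloor> = int i" using lo hi by (simp add: floor_eq_iff)
  moreover have "a \<noteq> 1" using hi assms(1) by auto
  ultimately show ?thesis by (simp add: func_rep_def)
qed

definition ord_func_rep :: "real list \<Rightarrow> real \<Rightarrow> real" where
  "ord_func_rep p = func_rep (sort p)"

definition mu_1_u :: "real list \<Rightarrow> real list \<Rightarrow> real" where
  "mu_1_u p q = integral {0..1} (\<lambda>x. \<bar>ord_func_rep p x - ord_func_rep q x\<bar>)"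

definition mu_inf_o :: "real list \<Rightarrow> real list \<Rightarrow> real" where
  "mu_inf_o p q = (SUP a\<in>{0..1}. \<bar>func_rep p a - func_rep q a\<bar>)"

definition mu_1_u_tuple :: "('m::finite \<Rightarrow> real list) \<Rightarrow> ('m \<Rightarrow> real list) \<Rightarrow> real" where
  "mu_1_u_tuple p q = (MAX i. mu_1_u (p i) (q i))"

definition asymp_uniformly_continuous_on ::
    "('m::finite \<Rightarrow> real list) set \<Rightarrow> (('m \<Rightarrow> real list) \<Rightarrow> real) \<Rightarrow> bool" where
  "asymp_uniformly_continuous_on X F \<longleftrightarrow>
     (\<forall>\<epsilon>>0. \<exists>n. \<exists>\<delta>>0. \<forall>p\<in>X. \<forall>q\<in>X.
        (\<forall>i. length (p i) \<ge> n \<and> length (q i) \<ge> n) \<longrightarrow> mu_1_u_tuple p q < \<delta> \<longrightarrow>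
          \<bar>F p - F q\<bar> < \<epsilon>)"

definition near_profile ::
    "nat \<Rightarrow> (nat \<Rightarrow> real) \<Rightarrow> (nat \<Rightarrow> real) \<Rightarrow> real \<Rightarrow> real list set" where
  "near_profile k c \<alpha> \<delta> =
     {p \<in> unit_seqs. set p \<subseteq> c ` {1..k} \<and>
        (\<forall>j\<in>{1..k}. real (count_list p (c j)) \<in>
           {(\<alpha> j - \<delta>) * real (length p)..(\<alpha> j + \<delta>) * real (length p)})}"

definition up_continuous ::
    "(('m::finite \<Rightarrow> real list) \<Rightarrow> real) \<Rightarrow>
     ('m \<Rightarrow> nat) \<Rightarrow> ('m \<Rightarrow> nat \<Rightarrow> real) \<Rightarrow> ('m \<Rightarrow> nat \<Rightarrow> real) \<Rightarrow> bool" where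
  "up_continuous F k c \<alpha> \<longleftrightarrow>
     (\<exists>\<delta>\<^sub>0>0. \<forall>\<delta>. 0 < \<delta> \<and> \<delta> < \<delta>\<^sub>0 \<longrightarrow>
        asymp_uniformly_continuous_on {p. \<forall>i. p i \<in> near_profile (k i) (c i) (\<alpha> i) \<delta>} F) \<and>
     (\<forall>\<epsilon>>0. \<exists>\<delta>>0. \<exists>n\<^sub>0. \<forall>p q.
        (\<forall>i. p i \<in> unit_seqs \<and> q i \<in> unit_seqs \<and>
             length (p i) = length (q i) \<and> length (p i) > n\<^sub>0 \<and>
             mu_inf_o (p i) (q i) < \<delta> \<and>
             p i \<in> near_profile (k i) (c i) (\<alpha> i) \<delta>) \<longrightarrow>
        \<bar>F p - F q\<bar> < \<epsilon>)"

end

theory Submission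
  imports Defs
begin

text \<open>On lists with entries in a fixed finite set, \<open>mu_1_u\<close> controls and is controlled by the differences
  of the entry frequencies. For (i), each term of a convergence testing sequence is rounded
  entrywise to the nearest parameter: \<open>mu_inf_o\<close> between a term and its rounding tends to 0, and the
  frequencies of the rounded lists converge to \<open>\<alpha>\<close>. For (ii), a failure of up-continuity yields two
  sequences witnessing it; by compactness their frequencies converge along a subsequence to a common
  limit \<open>\<alpha>'\<close> close to \<open>\<alpha>\<close>, and after thinning the lengths increase strictly, so that both are
  convergence testing for \<open>\<alpha>'\<close>, contradicting ct-continuity.\<close>

section \<open>Frequencies and the pseudometrics\<close>

definition freq :: "real list \<Rightarrow> real \<Rightarrow> real" where
  "freq p x = real (count_list p x) / real (length p)"

text \<open>The empirical distribution function of the entries. It mediates between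
  \<open>freq\<close> and \<open>mu_1_u\<close>: its jumps are the frequencies, and its generalized
  inverse is the function that \<open>mu_1_u\<close> integrates.\<close>

definition cdf :: "real list \<Rightarrow> real \<Rightarrow> real" where
  "cdf p t = real (length (filter (\<lambda>x. x \<le> t) p)) / real (length p)"

lemma count_list_eq_card: "count_list p x = card {i. i < length p \<and> p ! i = x}"
  by (simp add: count_list_eq_length_filter length_filter_conv_card eq_commute)

lemma freq_in_unit: "freq p x \<in> {0..1}"
  by (cases "p = []") (auto simp: freq_def count_le_length)

lemma cdf_in_unit: "cdf p t \<in> {0..1}"
  by (cases "p = []") (auto simp: cdf_def)

lemma cdf_sort: "cdf (sort p) t = cdf p t"
  by (simp add: cdf_def filter_sort)

lemma count_list_filter: "count_list (filter P p) x = (if P x then count_list p x else 0)"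
  by (induction p) auto

lemma length_filter_eq_sum_count_list:
  assumes "finite C" "set p \<subseteq> C"
  shows "length (filter P p) = (\<Sum>x\<in>{x\<in>C. P x}. count_list p x)"
proof -
  have "length (filter P p) = (\<Sum>x\<in>C. count_list (filter P p) x)"
    using assms by (intro sum_count_set[symmetric]) auto
  also have "\<dots> = (\<Sum>x\<in>C. if P x then count_list p x else 0)"
    by (intro sum.cong refl count_list_filter)
  finally show ?thesis
    using assms(1) by (simp add: sum.inter_filter)
qed

lemma cdf_eq_sum_freq:
  assumes "finite C" "set p \<subseteq> C"
  shows "cdf p t = (\<Sum>x\<in>{x\<in>C. x \<le> t}. freq p x)"
  unfolding cdf_def freq_def length_filter_eq_sum_count_list[OF assms]
  by (simp add: sum_divide_distrib)

lemma cdf_diff_le_freq: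
  assumes "finite C" "set p \<subseteq> C" "set q \<subseteq> C"
  shows "\<bar>cdf p t - cdf q t\<bar> \<le> (\<Sum>x\<in>C. \<bar>freq p x - freq q x\<bar>)"
proof -
  have "\<bar>cdf p t - cdf q t\<bar> = \<bar>\<Sum>x\<in>{x\<in>C. x \<le> t}. freq p x - freq q x\<bar>"
    using assms by (simp add: cdf_eq_sum_freq sum_subtractf)
  also have "\<dots> \<le> (\<Sum>x\<in>{x\<in>C. x \<le> t}. \<bar>freq p x - freq q x\<bar>)"
    by (rule sum_abs)
  also have "\<dots> \<le> (\<Sum>x\<in>C. \<bar>freq p x - freq q x\<bar>)"
    using assms(1) by (intro sum_mono2) auto
  finally show ?thesis .
qed

text \<open>No point of \<open>C\<close> lies in the interval from \<open>x - h\<close> (included)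
  to \<open>x\<close> (excluded), so the only jump of the distribution function between
  \<open>x - h\<close> and \<open>x\<close> is the one at \<open>x\<close>.\<close>

lemma freq_eq_cdf_diff:
  assumes "set p \<subseteq> C" "x \<in> C" "h > 0" "\<And>y. y \<in> C \<Longrightarrow> y \<noteq> x \<Longrightarrow> h < \<bar>y - x\<bar>"
  shows "freq p x = cdf p x - cdf p (x - h)"
proof -
  have eq: "{i. i < length p \<and> p ! i \<le> x} =
      {i. i < length p \<and> p ! i \<le> x - h} \<union> {i. i < length p \<and> p ! i = x}"
  proof (intro set_eqI iffI)
    fix i assume i: "i \<in> {i. i < length p \<and> p ! i \<le> x}"
    then have "p ! i \<in> C"
      using assms(1) nth_mem by blast
    then show "i \<in> {i. i < length p \<and> p ! i \<le> x - h} \<union> {i. i < length p \<and> p ! i = x}"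
      using i assms(4)[of "p ! i"] by (cases "p ! i = x") auto
  qed (use assms(3) in auto)
  have "card {i. i < length p \<and> p ! i \<le> x} =
      card {i. i < length p \<and> p ! i \<le> x - h} + card {i. i < length p \<and> p ! i = x}"
    unfolding eq using assms(3) by (intro card_Un_disjoint) auto
  then show ?thesis
    by (simp add: freq_def cdf_def length_filter_conv_card count_list_eq_card diff_divide_distrib
        add_divide_distrib)
qed

text \<open>The index is independent of the list, and the bounds on it include the exceptional
  point \<open>x = 1\<close>.\<close>

lemma func_rep_index:
  assumes "n > 0" "x \<in> {0..1}"
  obtains i where "i < n" "real i \<le> x * real n" "x * real n \<le> real i + 1"
    "\<And>p. length p = n \<Longrightarrow> func_rep p x = p ! i"
proof (cases "x = 1")
  case True
  with assms that[of "n - 1"] show ?thesis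
    by (force simp: func_rep_def last_conv_nth of_nat_diff)
next
  case False
  define i where "i = nat \<lfloor>x * real n\<rfloor>"
  have i: "real i = of_int \<lfloor>x * real n\<rfloor>"
    using assms by (simp add: i_def)
  have "x * real n < 1 * real n"
    using assms False by (intro mult_strict_right_mono) auto
  then have "i < n" "real i \<le> x * real n" "x * real n \<le> real i + 1"
    using i by linarith+
  then show ?thesis
    using that False by (simp add: func_rep_def i_def)
qed

lemma func_rep_nth:
  assumes "i < length p"
  shows "func_rep p (real i / real (length p)) = p ! i"
  using assms by (intro func_rep_eq) (auto intro!: divide_strict_right_mono)

lemma ord_func_rep_in_set:
  assumes "p \<noteq> []" "x \<in> {0..1}"
  shows "ord_func_rep p x \<in> set p"
proof -
  obtain i where "i < length p" "\<And>q :: real list. length q = length p \<Longrightarrow> func_rep q x = q ! i"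
    using func_rep_index[of "length p" x] assms by (metis length_greater_0_conv)
  then show ?thesis
    using nth_mem[of i "sort p"] by (simp add: ord_func_rep_def)
qed

text \<open>These two lemmas say that \<open>ord_func_rep p\<close> is the quantile function of the distribution function
  \<open>cdf p\<close>.\<close>

lemma ord_func_rep_le_imp:
  assumes "p \<noteq> []" "x \<in> {0..1}" "ord_func_rep p x \<le> t"
  shows "x \<le> cdf p t"
proof -
  define s where "s = sort p"
  have s: "sorted s" "length s = length p" "length p > 0"
    using assms(1) by (auto simp: s_def)
  obtain i where i: "i < length p" "x * real (length p) \<le> real i + 1" "func_rep s x = s ! i"
    using func_rep_index[of "length p" x] assms s by metis
  \<comment> \<open>In the sorted list every position up to \<open>i\<close> holds an entry at most
    \<open>t\<close>. These are \<open>i + 1\<close> positions, and \<open>x * n\<close> is at most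
    \<open>i + 1\<close>, where \<open>n\<close> is the length.\<close>
  have "{..i} \<subseteq> {j. j < length s \<and> s ! j \<le> t}"
    using assms(3) i s by (auto simp: ord_func_rep_def s_def[symmetric] intro: order_trans[OF sorted_nth_mono])
  then have "card {..i} \<le> card {j. j < length s \<and> s ! j \<le> t}"
    by (intro card_mono) auto
  then have "x * real (length p) \<le> real (length (filter (\<lambda>x. x \<le> t) s))"
    using i by (simp add: length_filter_conv_card)
  then have "x \<le> cdf s t"
    using s by (simp add: cdf_def pos_le_divide_eq)
  then show ?thesis
    by (simp add: s_def cdf_sort)
qed

lemma ord_func_rep_gt_imp:
  assumes "p \<noteq> []" "x \<in> {0..1}" "t < ord_func_rep p x"
  shows "cdf p t \<le> x"
proof -
  define s where "s = sort p"
  have s: "sorted s" "length s = length p" "length p > 0"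
    using assms(1) by (auto simp: s_def)
  obtain i where i: "i < length p" "real i \<le> x * real (length p)" "func_rep s x = s ! i"
    using func_rep_index[of "length p" x] assms s by metis
  \<comment> \<open>Position \<open>i\<close> holds an entry above \<open>t\<close>, so by
    sortedness the entries at most \<open>t\<close> occupy positions before \<open>i\<close>. There
    are at most \<open>i\<close> of them, and \<open>i\<close> is at most \<open>x * n\<close>,
    where \<open>n\<close> is the length.\<close>
  have "j < i" if "j < length s" "s ! j \<le> t" for j
    using assms(3) i s that sorted_nth_mono[of s i j]
    by (force simp: ord_func_rep_def s_def[symmetric])
  then have "{j. j < length s \<and> s ! j \<le> t} \<subseteq> {..<i}"
    by auto
  then have "card {j. j < length s \<and> s ! j \<le> t} \<le> card {..<i}"
    by (intro card_mono) auto
  then have "real (length (filter (\<lambda>x. x \<le> t) s)) \<le> x * real (length p)"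
    using i by (simp add: length_filter_conv_card)
  then have "cdf s t \<le> x"
    using s by (simp add: cdf_def pos_divide_le_eq)
  then show ?thesis
    by (simp add: s_def cdf_sort)
qed

section \<open>Comparison of \<open>mu_1_u\<close> with the entry frequencies\<close>

lemma borel_measurable_func_rep [measurable]: "func_rep p \<in> borel_measurable borel"
  unfolding func_rep_def by measurable

lemma integrable_ord_func_rep_diff:
  assumes "p \<in> unit_seqs" "q \<in> unit_seqs"
  shows "(\<lambda>x. \<bar>ord_func_rep p x - ord_func_rep q x\<bar>) integrable_on {0..1}"
proof (rule measurable_bounded_by_integrable_imp_integrable)
  show "(\<lambda>x. \<bar>ord_func_rep p x - ord_func_rep q x\<bar>) \<in> borel_measurable (lebesgue_on {0..1})"
    unfolding ord_func_rep_def
    by (intro measurable_restrict_space1 measurable_completion) simp_all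
  show "(\<lambda>x. 1 :: real) integrable_on {0..1 :: real}"
    by (rule integrable_const_ivl)
  show "norm \<bar>ord_func_rep p x - ord_func_rep q x\<bar> \<le> 1" if "x \<in> {0..1}" for x
    using ord_func_rep_in_set[of p x] ord_func_rep_in_set[of q x] assms that
    by (force simp: unit_seqs_def)
qed simp

text \<open>The integrand is dominated by the sum over \<open>t\<close> in \<open>C\<close> of the
  indicators of the intervals between \<open>cdf p t\<close> and \<open>cdf q t\<close>. Integration
  leaves the sum of the differences of the distribution functions, each at most the total frequency
  difference; hence the factor \<open>card C\<close>.\<close>

lemma mu_1_u_le:
  assumes C: "finite C" "C \<subseteq> {0..1}" and p: "p \<noteq> []" "set p \<subseteq> C" and q: "q \<noteq> []" "set q \<subseteq> C"
  shows "mu_1_u p q \<le> real (card C) * (\<Sum>x\<in>C. \<bar>freq p x - freq q x\<bar>)"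
proof -
  define J where "J t = {min (cdf p t) (cdf q t)..max (cdf p t) (cdf q t)}" for t
  define f where "f = (\<lambda>x. \<bar>ord_func_rep p x - ord_func_rep q x\<bar>)"
  have J: "((\<lambda>x. \<Sum>t\<in>C. indicator (J t) x) has_integral (\<Sum>t\<in>C. \<bar>cdf p t - cdf q t\<bar>)) {0..1}"
  proof (intro has_integral_sum C)
    fix t
    have "((\<lambda>x. indicator (J t) x :: real) has_integral \<bar>cdf p t - cdf q t\<bar>) (J t)"
      using has_integral_const_real[of "1 :: real" "min (cdf p t) (cdf q t)" "max (cdf p t) (cdf q t)"]
      by (subst has_integral_cong[where g = "\<lambda>_. 1"])
        (auto simp: J_def abs_real_def max_def min_def split: if_splits)
    moreover have "J t \<subseteq> {0..1}"
      using cdf_in_unit[of p t] cdf_in_unit[of q t] by (auto simp: J_def)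
    ultimately show "((\<lambda>x. indicator (J t) x :: real) has_integral \<bar>cdf p t - cdf q t\<bar>) {0..1}"
      using has_integral_on_superset[of "indicator (J t)" _ "J t" "{0..1}"] by simp
  qed
  have pt: "f x \<le> (\<Sum>t\<in>C. indicator (J t) x)" if x: "x \<in> {0..1}" for x
  proof -
    have in_C: "ord_func_rep p x \<in> C" "ord_func_rep q x \<in> C"
      using ord_func_rep_in_set x p q by blast+
    show ?thesis
    proof (cases "ord_func_rep p x = ord_func_rep q x")
      case True
      then show ?thesis by (simp add: f_def sum_nonneg)
    next
      case False
      \<comment> \<open>With \<open>t\<close> the smaller of the two quantiles at \<open>x\<close>,
        one quantile is at most \<open>t\<close> and the other exceeds it, which traps
        \<open>x\<close> between the two distribution functions at \<open>t\<close>.\<close>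
      define t where "t = min (ord_func_rep p x) (ord_func_rep q x)"
      have t: "t \<in> C" using in_C by (simp add: t_def min_def)
      have "x \<in> J t"
      proof (cases "ord_func_rep p x < ord_func_rep q x")
        case True
        then have "x \<le> cdf p t" "cdf q t \<le> x"
          using x p q by (auto intro!: ord_func_rep_le_imp ord_func_rep_gt_imp simp: t_def)
        then show ?thesis by (auto simp: J_def)
      next
        case 2: False
        then have "x \<le> cdf q t" "cdf p t \<le> x"
          using x p q False by (auto intro!: ord_func_rep_le_imp ord_func_rep_gt_imp simp: t_def)
        then show ?thesis by (auto simp: J_def)
      qed
      have "ord_func_rep p x \<in> {0..1}" "ord_func_rep q x \<in> {0..1}"
        using in_C C by auto
      then have "f x \<le> 1"
        by (auto simp: f_def)
      also have "1 = indicator (J t) x"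
        using \<open>x \<in> J t\<close> by simp
      also have "\<dots> \<le> (\<Sum>t\<in>C. indicator (J t) x :: real)"
        using t C by (intro member_le_sum) auto
      finally show ?thesis .
    qed
  qed
  have "p \<in> unit_seqs" "q \<in> unit_seqs"
    using C p q by (auto simp: unit_seqs_def)
  then have "(f has_integral mu_1_u p q) {0..1}"
    using integrable_ord_func_rep_diff by (simp add: f_def mu_1_u_def integrable_integral)
  then have "mu_1_u p q \<le> (\<Sum>t\<in>C. \<bar>cdf p t - cdf q t\<bar>)"
    using J pt by (rule has_integral_le)
  also have "\<dots> \<le> (\<Sum>t\<in>C. \<Sum>x\<in>C. \<bar>freq p x - freq q x\<bar>)"
    using C p q by (intro sum_mono cdf_diff_le_freq) auto
  finally show ?thesis by simp
qed

text \<open>For \<open>x\<close> strictly between \<open>cdf p t\<close> and \<open>cdf q t\<close>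
  the two quantiles lie on different sides of \<open>t\<close>. Being distinct points of
  \<open>C\<close>, they differ by at least \<open>g\<close>, so the integrand is at least
  \<open>g\<close> on an interval of the length in question.\<close>

lemma cdf_diff_le_mu_1_u:
  assumes p: "p \<in> unit_seqs" "set p \<subseteq> C" and q: "q \<in> unit_seqs" "set q \<subseteq> C"
    and gap: "g > 0" "\<And>x y. x \<in> C \<Longrightarrow> y \<in> C \<Longrightarrow> x \<noteq> y \<Longrightarrow> g \<le> \<bar>x - y\<bar>"
  shows "g * \<bar>cdf p t - cdf q t\<bar> \<le> mu_1_u p q"
proof -
  define a where "a = min (cdf p t) (cdf q t)"
  define b where "b = max (cdf p t) (cdf q t)"
  have ab: "a \<le> b" "\<bar>cdf p t - cdf q t\<bar> = b - a"
    by (auto simp: a_def b_def)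
  have sub: "{a..b} \<subseteq> {0..1}"
    using cdf_in_unit[of p t] cdf_in_unit[of q t] by (auto simp: a_def b_def)
  have ne: "p \<noteq> []" "q \<noteq> []"
    using p q by (auto simp: unit_seqs_def)
  define f where "f = (\<lambda>x. \<bar>ord_func_rep p x - ord_func_rep q x\<bar>)"
  \<comment> \<open>The minorant lives on the open interval, because at the endpoints the quantile
    lemmas do not separate the two quantiles.\<close>
  have "(\<lambda>x. if x \<in> {a<..<b} then g else 0) integrable_on {0..1}
      \<and> integral {0..1} (\<lambda>x. if x \<in> {a<..<b} then g else 0) = g * (b - a)"
  proof -
    have "((\<lambda>x. g) has_integral g * (b - a)) {a..b}"
      using has_integral_const_real[of g a b] ab by (simp add: mult.commute)
    then have "((\<lambda>x. g) has_integral g * (b - a)) {a<..<b}"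
      by (simp add: has_integral_Icc_iff_Ioo)
    then have "((\<lambda>x. if x \<in> {a<..<b} then g else 0) has_integral g * (b - a)) {0..1}"
      using sub by (subst has_integral_restrict) (auto simp: subset_eq)
    then show ?thesis
      by (auto simp: has_integral_integrable_integral)
  qed
  moreover have "(if x \<in> {a<..<b} then g else 0) \<le> f x" if x: "x \<in> {0..1}" for x
  proof (cases "x \<in> {a<..<b}")
    case True
    have in_C: "ord_func_rep p x \<in> C" "ord_func_rep q x \<in> C"
      using ord_func_rep_in_set x p q ne by blast+
    have "ord_func_rep p x \<noteq> ord_func_rep q x"
    proof (cases "cdf p t < cdf q t")
      case cdf_less: True
      then have "\<not> x \<le> cdf p t" "\<not> cdf q t \<le> x"
        using True by (auto simp: a_def b_def)
      then show ?thesis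
        using ord_func_rep_le_imp[of p x t] ord_func_rep_gt_imp[of q x t] ne x by force
    next
      case False
      then have "\<not> x \<le> cdf q t" "\<not> cdf p t \<le> x"
        using True by (auto simp: a_def b_def)
      then show ?thesis
        using ord_func_rep_le_imp[of q x t] ord_func_rep_gt_imp[of p x t] ne x by force
    qed
    then show ?thesis
      using gap(2)[OF in_C] True by (simp add: f_def)
  qed (auto simp: f_def)
  ultimately have "g * (b - a) \<le> integral {0..1} f"
    using integral_le[of "\<lambda>x. if x \<in> {a<..<b} then g else 0" "{0..1}" f]
      integrable_ord_func_rep_diff[OF p(1) q(1)]
    unfolding f_def by auto
  then show ?thesis
    by (simp add: f_def mu_1_u_def ab)
qed

text \<open>A frequency is a difference of two values of the distribution function, taken half a gap
  apart so that no other point of \<open>C\<close> interferes. Each value contributes an error of at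
  most \<open>mu_1_u p q / g\<close>.\<close>

lemma freq_diff_le_mu_1_u:
  assumes p: "p \<in> unit_seqs" "set p \<subseteq> C" and q: "q \<in> unit_seqs" "set q \<subseteq> C" and x: "x \<in> C"
    and gap: "g > 0" "\<And>x y. x \<in> C \<Longrightarrow> y \<in> C \<Longrightarrow> x \<noteq> y \<Longrightarrow> g \<le> \<bar>x - y\<bar>"
  shows "\<bar>freq p x - freq q x\<bar> \<le> 2 / g * mu_1_u p q"
proof -
  have far: "g / 2 < \<bar>y - x\<bar>" if "y \<in> C" "y \<noteq> x" for y
    using gap(2)[OF that(1) x that(2)] gap(1) by linarith
  have g2: "g / 2 > 0"
    using gap(1) by simp
  have bound: "\<bar>cdf p t - cdf q t\<bar> \<le> mu_1_u p q / g" for t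
    using cdf_diff_le_mu_1_u[OF p q gap, of t] gap(1) by (simp add: pos_le_divide_eq mult.commute)
  have fp: "freq p x = cdf p x - cdf p (x - g / 2)"
    using freq_eq_cdf_diff[OF p(2) x g2] far by blast
  have fq: "freq q x = cdf q x - cdf q (x - g / 2)"
    using freq_eq_cdf_diff[OF q(2) x g2] far by blast
  show ?thesis
    using bound[of x] bound[of "x - g / 2"] unfolding fp fq by (simp add: abs_le_iff)
qed

section \<open>Gaps of finite sets, the supremum pseudometric, and profiles\<close>

lemma finite_real_set_gap:
  fixes C :: "real set"
  assumes "finite C"
  obtains g where "g > 0" "\<And>x y. x \<in> C \<Longrightarrow> y \<in> C \<Longrightarrow> x \<noteq> y \<Longrightarrow> g \<le> \<bar>x - y\<bar>"
proof
  \<comment> \<open>The element 1 keeps the set nonempty when \<open>C\<close> has at most one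
    point, so that \<open>Min\<close> is meaningful.\<close>
  define D where "D = insert 1 ((\<lambda>(x, y). \<bar>x - y\<bar>) ` ((C \<times> C) - Id))"
  have fin: "finite D"
    using assms by (simp add: D_def)
  show "Min D > 0"
    using fin by (subst Min_gr_iff) (auto simp: D_def)
  show "Min D \<le> \<bar>x - y\<bar>" if "x \<in> C" "y \<in> C" "x \<noteq> y" for x y
    using fin that by (intro Min_le) (auto simp: D_def)
qed

lemma nth_in_unit: "p \<in> unit_seqs \<Longrightarrow> i < length p \<Longrightarrow> p ! i \<in> {0..1}"
  using nth_mem[of i p] by (auto simp: unit_seqs_def simp del: nth_mem)

lemma mu_inf_o_le:
  assumes "p \<noteq> []" "length q = length p" "\<And>i. i < length p \<Longrightarrow> \<bar>p ! i - q ! i\<bar> \<le> d"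
  shows "mu_inf_o p q \<le> d"
  unfolding mu_inf_o_def
proof (rule cSUP_least)
  fix x :: real assume "x \<in> {0..1}"
  then obtain i where "i < length p"
      "\<And>r :: real list. length r = length p \<Longrightarrow> func_rep r x = r ! i"
    using func_rep_index[of "length p" x] assms(1) by (metis length_greater_0_conv)
  then show "\<bar>func_rep p x - func_rep q x\<bar> \<le> d"
    using assms by simp
qed simp

text \<open>At the argument \<open>i / n\<close>, with \<open>n\<close> the common length, both
  representations return the entries at \<open>i\<close>. A real supremum bounds its family only if
  that family is bounded above; entries in [0,1] give the bound 1.\<close>

lemma nth_diff_le_mu_inf_o:
  assumes "p \<in> unit_seqs" "q \<in> unit_seqs" "length q = length p" "i < length p"
  shows "\<bar>p ! i - q ! i\<bar> \<le> mu_inf_o p q"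
proof -
  have "bdd_above ((\<lambda>x. \<bar>func_rep p x - func_rep q x\<bar>) ` {0..1})"
  proof (rule bdd_aboveI2)
    fix x :: real assume "x \<in> {0..1}"
    then obtain i where "i < length p"
        "\<And>r :: real list. length r = length p \<Longrightarrow> func_rep r x = r ! i"
      using func_rep_index[of "length p" x] assms by (metis gr_implies_not0 gr0I)
    moreover from this have "p ! i \<in> {0..1}" "q ! i \<in> {0..1}"
      using nth_in_unit[OF assms(1)] nth_in_unit[OF assms(2)] assms(3) by simp_all
    ultimately show "\<bar>func_rep p x - func_rep q x\<bar> \<le> 1"
      using assms by auto
  qed
  moreover have "real i / real (length p) \<in> {0..1}"
    using assms(4) by (simp add: divide_le_eq_1)
  ultimately have "\<bar>func_rep p (real i / real (length p)) - func_rep q (real i / real (length p))\<bar> \<le> mu_inf_o p q"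
    unfolding mu_inf_o_def by (intro cSUP_upper)
  then show ?thesis
    using func_rep_nth[of i p] func_rep_nth[of i q] assms by simp
qed

lemma near_profile_iff_freq:
  "p \<in> near_profile k c \<alpha> \<delta> \<longleftrightarrow>
     p \<in> unit_seqs \<and> set p \<subseteq> c ` {1..k} \<and> (\<forall>j\<in>{1..k}. \<bar>freq p (c j) - \<alpha> j\<bar> \<le> \<delta>)"
proof -
  have "real (count_list p x) \<in> {(a - \<delta>) * real (length p)..(a + \<delta>) * real (length p)} \<longleftrightarrow>
      \<bar>freq p x - a\<bar> \<le> \<delta>" if "p \<in> unit_seqs" for x a
  proof -
    have "real (length p) > 0"
      using that by (auto simp: unit_seqs_def)
    then have "real (count_list p x) \<in> {(a - \<delta>) * real (length p)..(a + \<delta>) * real (length p)} \<longleftrightarrow>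
        a - \<delta> \<le> freq p x \<and> freq p x \<le> a + \<delta>"
      by (simp add: freq_def pos_le_divide_eq pos_divide_le_eq)
    then show ?thesis
      by (simp only: abs_le_iff) linarith
  qed
  then show ?thesis
    by (auto simp: near_profile_def)
qed

lemma mu_1_u_tuple_less_iff: "mu_1_u_tuple p q < d \<longleftrightarrow> (\<forall>i. mu_1_u (p i) (q i) < d)"
  by (simp add: mu_1_u_tuple_def)

section \<open>Convergence testing sequences\<close>

text \<open>A criterion that gives convergence testing once the lengths increase strictly. Leaving
  the lengths out lets it pass to subsequences, so that thinning can come last. The lists
  \<open>r n\<close> are exact profiles approximated by \<open>p n\<close>; the error
  \<open>e n\<close> allows for entries that only approach the parameters.\<close>

definition approx_profile ::
    "nat \<Rightarrow> (nat \<Rightarrow> real) \<Rightarrow> (nat \<Rightarrow> real) \<Rightarrow> (nat \<Rightarrow> real list) \<Rightarrow> bool" where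
  "approx_profile k c \<alpha> p \<longleftrightarrow>
     (\<forall>n. p n \<in> unit_seqs) \<and>
     (\<exists>r e. (\<forall>n. length (r n) = length (p n) \<and> set (r n) \<subseteq> c ` {1..k} \<and>
                 (\<forall>i<length (p n). \<bar>p n ! i - r n ! i\<bar> \<le> e n)) \<and>
            e \<longlonglongrightarrow> 0 \<and> (\<forall>j\<in>{1..k}. (\<lambda>n. freq (r n) (c j)) \<longlonglongrightarrow> \<alpha> j))"

lemma approx_profile_subseq:
  assumes "approx_profile k c \<alpha> p" "strict_mono s"
  shows "approx_profile k c \<alpha> (p \<circ> s)"
proof -
  from assms(1) obtain r e where re:
    "\<forall>n. p n \<in> unit_seqs"
    "\<forall>n. length (r n) = length (p n) \<and> set (r n) \<subseteq> c ` {1..k} \<and>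
       (\<forall>i<length (p n). \<bar>p n ! i - r n ! i\<bar> \<le> e n)"
    "e \<longlonglongrightarrow> 0" "\<forall>j\<in>{1..k}. (\<lambda>n. freq (r n) (c j)) \<longlonglongrightarrow> \<alpha> j"
    unfolding approx_profile_def by blast
  have "(e \<circ> s) \<longlonglongrightarrow> 0"
    using re(3) assms(2) by (rule LIMSEQ_subseq_LIMSEQ)
  moreover have "(\<lambda>n. freq ((r \<circ> s) n) (c j)) \<longlonglongrightarrow> \<alpha> j" if "j \<in> {1..k}" for j
    using LIMSEQ_subseq_LIMSEQ[OF re(4)[rule_format, OF that] assms(2)] by (simp add: o_def)
  ultimately show ?thesis
    unfolding approx_profile_def using re(1,2)
    by (intro conjI exI[of _ "r \<circ> s"] exI[of _ "e \<circ> s"]) auto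
qed

lemma approx_profile_self:
  assumes "\<And>n. p n \<in> unit_seqs" "\<And>n. set (p n) \<subseteq> c ` {1..k}"
    and "\<And>j. j \<in> {1..k} \<Longrightarrow> (\<lambda>n. freq (p n) (c j)) \<longlonglongrightarrow> \<alpha> j"
  shows "approx_profile k c \<alpha> p"
  unfolding approx_profile_def using assms
  by (intro conjI exI[of _ p] exI[of _ "\<lambda>_. 0"]) auto

text \<open>Once \<open>e n\<close> is below the radius of a neighbourhood of each parameter inside
  its interval, every entry of \<open>p n\<close> lies in the interval of the corresponding entry of
  \<open>r n\<close>, and by disjointness in no other. From then on, counting entries of
  \<open>p n\<close> in \<open>I j\<close> is counting occurrences of \<open>c j\<close> in
  \<open>r n\<close>.\<close>

lemma convergence_testing_if_approx_profile:
  assumes "approx_profile k c \<alpha> p" and incr: "\<And>n. length (p n) < length (p (Suc n))"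
  shows "convergence_testing k c \<alpha> p"
proof -
  from assms(1) obtain r e where
    unit: "\<And>n. p n \<in> unit_seqs" and
    r: "\<And>n. length (r n) = length (p n)" "\<And>n. set (r n) \<subseteq> c ` {1..k}" and
    close: "\<And>n i. i < length (p n) \<Longrightarrow> \<bar>p n ! i - r n ! i\<bar> \<le> e n" and
    e: "e \<longlonglongrightarrow> 0" and lim: "\<And>j. j \<in> {1..k} \<Longrightarrow> (\<lambda>n. freq (r n) (c j)) \<longlonglongrightarrow> \<alpha> j"
    unfolding approx_profile_def by blast
  show ?thesis
    unfolding convergence_testing_def
  proof (intro conjI allI impI)
    fix I :: "nat \<Rightarrow> real set"
    assume I: "\<forall>j\<in>{1..k}. is_interval (I j) \<and> openin (top_of_set {0..1}) (I j) \<and> c j \<in> I j"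
      and disj: "disjoint_family_on I {1..k}"
    have "\<forall>j\<in>{1..k}. \<exists>d>0. \<forall>y\<in>{0..1}. \<bar>y - c j\<bar> < d \<longrightarrow> y \<in> I j"
    proof
      fix j assume "j \<in> {1..k}"
      then have "openin (top_of_set {0..1}) (I j)" "c j \<in> I j"
        using I by auto
      then show "\<exists>d>0. \<forall>y\<in>{0..1}. \<bar>y - c j\<bar> < d \<longrightarrow> y \<in> I j"
        by (auto simp: openin_euclidean_subtopology_iff dist_real_def)
    qed
    then obtain d where d: "\<And>j. j \<in> {1..k} \<Longrightarrow> d j > 0"
      "\<And>j y. j \<in> {1..k} \<Longrightarrow> y \<in> {0..1} \<Longrightarrow> \<bar>y - c j\<bar> < d j \<Longrightarrow> y \<in> I j"
      by metis
    have "\<forall>\<^sub>F n in sequentially. \<forall>j\<in>{1..k}. e n < d j"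
      using d(1) e by (intro eventually_ball_finite) (auto intro: order_tendstoD)
    then obtain N where N: "\<And>n j. n \<ge> N \<Longrightarrow> j \<in> {1..k} \<Longrightarrow> e n < d j"
      unfolding eventually_sequentially by blast
    have in_I: "p n ! i \<in> I j" if "n \<ge> N" "i < length (p n)" "j \<in> {1..k}" "r n ! i = c j" for n i j
    proof (rule d(2))
      show "p n ! i \<in> {0..1}"
        using nth_in_unit[OF unit that(2)] .
      show "\<bar>p n ! i - c j\<bar> < d j"
        using close[OF that(2)] N[OF that(1,3)] that(4) by simp
    qed (fact that(3))
    have r_eq: "\<exists>j\<in>{1..k}. r n ! i = c j" if "i < length (p n)" for n i
      using subsetD[OF r(2) nth_mem, of i n] that r(1)[of n] by auto
    show "\<exists>N. \<forall>n\<ge>N. set (p n) \<subseteq> (\<Union>j\<in>{1..k}. I j)"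
    proof (intro exI allI impI subsetI)
      fix n x assume n: "N \<le> n" and "x \<in> set (p n)"
      then obtain i where i: "i < length (p n)" "x = p n ! i"
        by (auto simp: in_set_conv_nth)
      with r_eq[OF i(1)] in_I[OF n i(1)] show "x \<in> (\<Union>j\<in>{1..k}. I j)"
        by blast
    qed
    show "\<forall>j\<in>{1..k}. (\<lambda>n. real (card {i. i < length (p n) \<and> p n ! i \<in> I j}) / real (length (p n)))
       \<longlonglongrightarrow> \<alpha> j"
    proof
      fix j assume j: "j \<in> {1..k}"
      have "{i. i < length (p n) \<and> p n ! i \<in> I j} = {i. i < length (r n) \<and> r n ! i = c j}"
        if n: "n \<ge> N" for n
      proof -
        have "r n ! i = c j" if i: "i < length (p n)" "p n ! i \<in> I j" for i
        proof -
          obtain l where l: "l \<in> {1..k}" "r n ! i = c l"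
            using r_eq i by blast
          then have "p n ! i \<in> I l"
            using in_I n i by blast
          then have "l = j"
            using disj[unfolded disjoint_family_on_def] i(2) l(1) j by blast
          then show ?thesis using l by simp
        qed
        then show ?thesis
          using in_I[OF n] j r(1) by auto
      qed
      then have "\<forall>\<^sub>F n in sequentially. freq (r n) (c j) =
          real (card {i. i < length (p n) \<and> p n ! i \<in> I j}) / real (length (p n))"
        unfolding eventually_sequentially
        by (intro exI[of _ N]) (simp add: freq_def count_list_eq_card r)
      then show "(\<lambda>n. real (card {i. i < length (p n) \<and> p n ! i \<in> I j}) / real (length (p n)))
          \<longlonglongrightarrow> \<alpha> j"
        using lim[OF j] by (rule Lim_transform_eventually[rotated])
    qed
  qed (use unit incr in auto)
qed

section \<open>Rounding to the nearest parameter\<close>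

text \<open>Ties are resolved arbitrarily. The value is pinned down, by \<open>nearest_eqI\<close>,
  for points closer to an element of \<open>C\<close> than half the gap; elsewhere only membership
  in \<open>C\<close> is used.\<close>

definition nearest :: "real set \<Rightarrow> real \<Rightarrow> real" where
  "nearest C y = arg_min_on (\<lambda>z. \<bar>y - z\<bar>) C"

lemma nearest_in: "finite C \<Longrightarrow> C \<noteq> {} \<Longrightarrow> nearest C y \<in> C"
  unfolding nearest_def by (rule arg_min_if_finite)

lemma nearest_eqI:
  assumes "finite C" "x \<in> C" "\<bar>y - x\<bar> < d" "2 * d \<le> g"
    and "\<And>x y. x \<in> C \<Longrightarrow> y \<in> C \<Longrightarrow> x \<noteq> y \<Longrightarrow> g \<le> \<bar>x - y\<bar>"
  shows "nearest C y = x"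
proof (rule ccontr)
  assume "nearest C y \<noteq> x"
  then have "g \<le> \<bar>nearest C y - x\<bar>"
    using assms nearest_in[of C y] by (intro assms(5)) auto
  moreover have "\<bar>y - nearest C y\<bar> \<le> \<bar>y - x\<bar>"
    using arg_min_least[OF assms(1) _ assms(2), of "\<lambda>z. \<bar>y - z\<bar>"] assms(2)
    by (auto simp: nearest_def)
  ultimately show False
    using assms(3,4) by linarith
qed

text \<open>Small intervals around the distinct parameters are admissible in the definition of
  convergence testing. Eventually all entries lie in them, so rounding moves each entry by less than
  the radius, and the entries rounded to \<open>c j\<close> are exactly those in
  \<open>I j\<close>.\<close>

lemma convergence_testing_nearest:
  fixes k c \<alpha> p
  defines "C \<equiv> c ` {1..k}"
  assumes ct: "convergence_testing k c \<alpha> p" and k: "k \<ge> 1" and inj: "inj_on c {1..k}"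
    and c: "c ` {1..k} \<subseteq> {0..1}" and d: "d > 0"
  shows "\<forall>\<^sub>F n in sequentially. mu_inf_o (map (nearest C) (p n)) (p n) < d"
    and "j \<in> {1..k} \<Longrightarrow> (\<lambda>n. freq (map (nearest C) (p n)) (c j)) \<longlonglongrightarrow> \<alpha> j"
proof -
  have C: "finite C" "C \<noteq> {}"
    using k by (auto simp: C_def)
  obtain g where g: "g > 0" "\<And>x y. x \<in> C \<Longrightarrow> y \<in> C \<Longrightarrow> x \<noteq> y \<Longrightarrow> g \<le> \<bar>x - y\<bar>"
    using finite_real_set_gap[OF C(1)] by metis
  \<comment> \<open>One radius for two purposes: it is below \<open>d\<close>, which bounds the
    displacement, and at most half the gap, which makes rounding constant on each interval.\<close>
  define h where "h = min d g / 2"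
  have h: "h > 0" "h < d" "2 * h \<le> g"
    using d g by (auto simp: h_def)
  define I where "I j = {0..1} \<inter> ball (c j) h" for j
  have near: "nearest C y = c j" if "j \<in> {1..k}" "y \<in> I j" for j y
    using that g h C(1)
    by (intro nearest_eqI[of C "c j" y h g]) (auto simp: C_def I_def dist_real_def)
  have "\<forall>j\<in>{1..k}. is_interval (I j) \<and> openin (top_of_set {0..1}) (I j) \<and> c j \<in> I j"
    using c h(1) by (auto simp: I_def is_interval_ball_real is_interval_cc intro!: is_interval_Int openin_open_Int)
  \<comment> \<open>A common point of two of the intervals would be rounded to both centres, against
    injectivity.\<close>
  moreover have "disjoint_family_on I {1..k}"
    unfolding disjoint_family_on_def using near inj_onD[OF inj] by (metis disjoint_iff)
  ultimately have "(\<exists>N. \<forall>n\<ge>N. set (p n) \<subseteq> (\<Union>j\<in>{1..k}. I j)) \<and> (\<forall>j\<in>{1..k}.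
      (\<lambda>n. real (card {i. i < length (p n) \<and> p n ! i \<in> I j}) / real (length (p n))) \<longlonglongrightarrow> \<alpha> j)"
    using ct unfolding convergence_testing_def by simp
  then obtain N where N: "\<And>n. n \<ge> N \<Longrightarrow> set (p n) \<subseteq> (\<Union>j\<in>{1..k}. I j)"
    and lim: "\<And>j. j \<in> {1..k} \<Longrightarrow>
      (\<lambda>n. real (card {i. i < length (p n) \<and> p n ! i \<in> I j}) / real (length (p n))) \<longlonglongrightarrow> \<alpha> j"
    by blast
  have unit: "p n \<in> unit_seqs" for n
    using ct by (simp add: convergence_testing_def)
  have "mu_inf_o (map (nearest C) (p n)) (p n) \<le> h" if n: "n \<ge> N" for n
  proof (rule mu_inf_o_le)
    fix i assume "i < length (map (nearest C) (p n))"
    then have i: "i < length (p n)" by simp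
    then obtain j where j: "j \<in> {1..k}" "p n ! i \<in> I j"
      using N[OF n] nth_mem by blast
    then show "\<bar>map (nearest C) (p n) ! i - p n ! i\<bar> \<le> h"
      using near[OF j] i by (auto simp: I_def dist_real_def)
  qed (use unit[of n] in \<open>auto simp: unit_seqs_def\<close>)
  then show "\<forall>\<^sub>F n in sequentially. mu_inf_o (map (nearest C) (p n)) (p n) < d"
    unfolding eventually_sequentially using h(2) by (meson le_less_trans)
  assume j: "j \<in> {1..k}"
  have "{i. i < length (p n) \<and> p n ! i \<in> I j} =
      {i. i < length (p n) \<and> nearest C (p n ! i) = c j}" if n: "n \<ge> N" for n
  proof (intro Collect_cong conj_cong refl iffI)
    fix i assume i: "i < length (p n)" "nearest C (p n ! i) = c j"
    then obtain l where l: "l \<in> {1..k}" "p n ! i \<in> I l"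
      using N[OF n] nth_mem by blast
    then have "l = j"
      using near[OF l] i(2) inj_onD[OF inj _ l(1) j] by simp
    then show "p n ! i \<in> I j" using l by simp
  qed (use near j in auto)
  then have "\<forall>\<^sub>F n in sequentially.
      real (card {i. i < length (p n) \<and> p n ! i \<in> I j}) / real (length (p n)) =
      freq (map (nearest C) (p n)) (c j)"
    unfolding eventually_sequentially
    by (intro exI[of _ N]) (simp add: freq_def count_list_eq_card cong: conj_cong)
  then show "(\<lambda>n. freq (map (nearest C) (p n)) (c j)) \<longlonglongrightarrow> \<alpha> j"
    using lim[OF j] by (rule Lim_transform_eventually[rotated])
qed

section \<open>Extraction of subsequences\<close>

text \<open>Compactness of [0,1] is applied to one index at a time; the limits already obtained
  survive the passage to a further subsequence.\<close>

lemma simultaneous_convergent_subseq: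
  fixes f :: "'a \<Rightarrow> nat \<Rightarrow> real"
  assumes "finite A" "\<And>a n. a \<in> A \<Longrightarrow> f a n \<in> {0..1}"
  shows "\<exists>s. strict_mono s \<and> (\<forall>a\<in>A. \<exists>l. (f a \<circ> s) \<longlonglongrightarrow> l)"
  using assms
proof (induction A rule: finite_induct)
  case empty
  then show ?case
    by (auto intro: strict_mono_id)
next
  case (insert a A)
  then obtain s where s: "strict_mono s" "\<forall>a\<in>A. \<exists>l. (f a \<circ> s) \<longlonglongrightarrow> l"
    by (metis insertCI)
  have "\<forall>n. (f a \<circ> s) n \<in> {0..1}"
    using insert.prems by auto
  then obtain l t where t: "strict_mono t" "((f a \<circ> s) \<circ> t) \<longlonglongrightarrow> l"
    using compact_imp_seq_compact[OF compact_Icc, of "0 :: real" 1] unfolding seq_compact_def by metis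
  have "\<exists>l. (f b \<circ> (s \<circ> t)) \<longlonglongrightarrow> l" if "b \<in> insert a A" for b
  proof (cases "b = a")
    case True
    then show ?thesis using t(2) by (auto simp: o_assoc)
  next
    case False
    then obtain l where "(f b \<circ> s) \<longlonglongrightarrow> l"
      using \<open>b \<in> insert a A\<close> s(2) by blast
    from LIMSEQ_subseq_LIMSEQ[OF this t(1)] show ?thesis
      by (auto simp: o_assoc)
  qed
  then show ?case
    using strict_mono_o[OF s(1) t(1)] by blast
qed

text \<open>Choose \<open>s (Suc n)\<close> above the finitely many values \<open>l a (s n)\<close>.
  Since \<open>l a\<close> dominates the identity, \<open>l a (s (Suc n))\<close> is at least
  \<open>s (Suc n)\<close>, hence above \<open>l a (s n)\<close>, which in turn is at least
  \<open>s n\<close>.\<close>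

lemma increasing_subseq:
  fixes l :: "'a :: finite \<Rightarrow> nat \<Rightarrow> nat"
  assumes "\<And>a n. n \<le> l a n"
  obtains s :: "nat \<Rightarrow> nat" where "strict_mono s" "\<And>a n. l a (s n) < l a (s (Suc n))"
proof -
  \<comment> \<open>The conjunct \<open>True\<close> fills the place of the invariant in
    \<open>dependent_nat_choice\<close>.\<close>
  have "\<exists>s. \<forall>n. True \<and> (\<forall>a. l a (s n) < s (Suc n))"
  proof (rule dependent_nat_choice)
    show "\<exists>y. True \<and> (\<forall>a. l a x < y)" for x :: nat and n :: nat
    proof (intro exI conjI allI TrueI)
      fix a
      have "l a x \<le> Max (range (\<lambda>a. l a x))" by (intro Max_ge) auto
      then show "l a x < Suc (Max (range (\<lambda>a. l a x)))" by (rule le_imp_less_Suc)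
    qed
  qed simp
  then obtain s where s: "\<And>a n. l a (s n) < s (Suc n)"
    by blast
  have "strict_mono s"
    unfolding strict_mono_Suc_iff using s assms le_less_trans by blast
  moreover have "l a (s n) < l a (s (Suc n))" for a n
    using s[of a n] assms[of "s (Suc n)" a] by linarith
  ultimately show ?thesis using that by blast
qed

text \<open>The form in which ct-continuity is contradicted later: lengths need only be at least
  \<open>n\<close>, because thinning makes them strictly increasing, and a single index with a small
  difference of values is enough.\<close>

lemma ct_continuous_approx_profile:
  fixes F :: "('m::finite \<Rightarrow> real list) \<Rightarrow> real"
  assumes ct: "ct_continuous F k c \<alpha>" and "\<epsilon> > 0"
    and p: "\<And>i. approx_profile (k i) (c i) (\<alpha> i) (\<lambda>n. p n i)" "\<And>i n. n \<le> length (p n i)"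
    and q: "\<And>i. approx_profile (k i) (c i) (\<alpha> i) (\<lambda>n. q n i)" "\<And>i n. n \<le> length (q n i)"
  shows "\<exists>n. \<bar>F (p n) - F (q n)\<bar> < \<epsilon>"
proof -
  \<comment> \<open>The sum type collects the components of both tuples, so that a single
    subsequence thins \<open>p\<close> and \<open>q\<close> together and their terms stay
    paired.\<close>
  define l where "l a n = (case a of Inl i \<Rightarrow> length (p n i) | Inr i \<Rightarrow> length (q n i))" for a :: "'m + 'm" and n
  have "n \<le> l a n" for a n
    using p q by (auto simp: l_def split: sum.split)
  then obtain s where s: "strict_mono s" "\<And>a n. l a (s n) < l a (s (Suc n))"
    using increasing_subseq by blast
  have "convergence_testing_tuple k c \<alpha> (p \<circ> s)"
    unfolding convergence_testing_tuple_def
    using s(2)[of "Inl _"] approx_profile_subseq[OF p(1) s(1)]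
    by (auto intro!: convergence_testing_if_approx_profile simp: l_def o_def)
  moreover have "convergence_testing_tuple k c \<alpha> (q \<circ> s)"
    unfolding convergence_testing_tuple_def
    using s(2)[of "Inr _"] approx_profile_subseq[OF q(1) s(1)]
    by (auto intro!: convergence_testing_if_approx_profile simp: l_def o_def)
  ultimately have "(\<lambda>n. \<bar>F ((p \<circ> s) n) - F ((q \<circ> s) n)\<bar>) \<longlonglongrightarrow> 0"
    using ct unfolding ct_continuous_def by blast
  from order_tendstoD(2)[OF this \<open>\<epsilon> > 0\<close>] show ?thesis
    by (auto simp: eventually_sequentially)
qed

section \<open>Asymptotics of rounded convergence testing sequences\<close>

lemma convergence_testing_unit: "convergence_testing k c \<alpha> p \<Longrightarrow> p n \<in> unit_seqs"
  by (simp add: convergence_testing_def)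

lemma convergence_testing_length:
  assumes "convergence_testing k c \<alpha> p"
  shows "\<forall>\<^sub>F n in sequentially. N < length (p n)"
proof -
  have "strict_mono (\<lambda>n. length (p n))"
    using assms by (simp add: convergence_testing_def strict_mono_Suc_iff)
  then have "N < length (p n)" if "n \<ge> Suc N" for n
    using seq_suble[of "\<lambda>n. length (p n)" n] that by linarith
  then show ?thesis
    unfolding eventually_sequentially by blast
qed

lemma convergence_testing_nearest_near_profile:
  assumes ct: "convergence_testing k c \<alpha> p" and k: "k \<ge> 1" and inj: "inj_on c {1..k}"
    and c: "c ` {1..k} \<subseteq> {0..1}" and d: "d > 0"
  shows "\<forall>\<^sub>F n in sequentially. map (nearest (c ` {1..k})) (p n) \<in> near_profile k c \<alpha> d"
proof -
  have in_C: "nearest (c ` {1..k}) y \<in> c ` {1..k}" for y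
    using k by (intro nearest_in) auto
  then have "map (nearest (c ` {1..k})) (p n) \<in> unit_seqs"
      "set (map (nearest (c ` {1..k})) (p n)) \<subseteq> c ` {1..k}" for n
    using c convergence_testing_unit[OF ct, of n] by (auto simp: unit_seqs_def)
  moreover have "\<forall>\<^sub>F n in sequentially.
      \<forall>j\<in>{1..k}. \<bar>freq (map (nearest (c ` {1..k})) (p n)) (c j) - \<alpha> j\<bar> < d"
    using convergence_testing_nearest(2)[OF ct k inj c d] d
    by (intro eventually_ball_finite) (auto simp: tendsto_iff dist_real_def)
  ultimately show ?thesis
    unfolding near_profile_iff_freq by (auto elim!: eventually_mono intro: less_imp_le)
qed

text \<open>Both rounded sequences have frequencies tending to the same \<alpha>, and
  \<open>mu_1_u_le\<close> bounds their distance by a fixed multiple of the sum of the frequency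
  differences.\<close>

lemma convergence_testing_nearest_mu_1_u:
  assumes p: "convergence_testing k c \<alpha> p" and q: "convergence_testing k c \<alpha> q"
    and k: "k \<ge> 1" and inj: "inj_on c {1..k}" and c: "c ` {1..k} \<subseteq> {0..1}" and d: "d > 0"
  shows "\<forall>\<^sub>F n in sequentially.
    mu_1_u (map (nearest (c ` {1..k})) (p n)) (map (nearest (c ` {1..k})) (q n)) < d"
proof -
  define C where "C = c ` {1..k}"
  have C: "finite C" "C \<subseteq> {0..1}" "nearest C y \<in> C" for y
    using k c by (auto simp: C_def intro!: nearest_in)
  define f where "f r x n = freq (map (nearest C) (r n)) x" for r :: "nat \<Rightarrow> real list" and x n
  have "(\<lambda>n. real (card C) * (\<Sum>x\<in>C. \<bar>f p x n - f q x n\<bar>)) \<longlonglongrightarrow> real (card C) * (\<Sum>x\<in>C. 0)"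
  proof (intro tendsto_intros)
    fix x assume "x \<in> C"
    then obtain j where j: "j \<in> {1..k}" "x = c j" by (auto simp: C_def)
    have "(\<lambda>n. f p x n - f q x n) \<longlonglongrightarrow> \<alpha> j - \<alpha> j"
      using convergence_testing_nearest(2)[OF p k inj c d j(1)]
        convergence_testing_nearest(2)[OF q k inj c d j(1)]
      unfolding f_def C_def j(2) by (rule tendsto_diff)
    then show "(\<lambda>n. \<bar>f p x n - f q x n\<bar>) \<longlonglongrightarrow> 0"
      by (intro tendsto_rabs_zero) simp
  qed
  then have "\<forall>\<^sub>F n in sequentially. real (card C) * (\<Sum>x\<in>C. \<bar>f p x n - f q x n\<bar>) < d"
    using d by (auto intro: order_tendstoD)
  moreover have "mu_1_u (map (nearest C) (p n)) (map (nearest C) (q n))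
      \<le> real (card C) * (\<Sum>x\<in>C. \<bar>f p x n - f q x n\<bar>)" for n
    unfolding f_def using C convergence_testing_unit[OF p, of n] convergence_testing_unit[OF q, of n]
    by (intro mu_1_u_le) (auto simp: unit_seqs_def)
  ultimately show ?thesis
    unfolding C_def by (auto elim!: eventually_mono intro: le_less_trans)
qed

section \<open>The two kinds of continuity\<close>

text \<open>The difference of values at \<open>p n\<close> and \<open>q n\<close> is split at the
  two rounded tuples into three parts, each eventually below a third of \<epsilon>. Clause (2) of
  up-continuity handles the two outer parts, clause (1) the middle one.\<close>

lemma up_continuous_imp_ct_continuous:
  fixes F :: "('m::finite \<Rightarrow> real list) \<Rightarrow> real"
  assumes up: "up_continuous F k c \<alpha>"
    and k: "\<And>i. k i \<ge> 1" and inj: "\<And>i. inj_on (c i) {1..k i}"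
    and c: "\<And>i. c i ` {1..k i} \<subseteq> {0..1}"
  shows "ct_continuous F k c \<alpha>"
  unfolding ct_continuous_def
proof (intro allI impI)
  fix p q
  assume p: "convergence_testing_tuple k c \<alpha> p" and q: "convergence_testing_tuple k c \<alpha> q"
  define R where "R t i = map (nearest (c i ` {1..k i})) (t i)" for t i
  have eventually_R: "\<forall>\<^sub>F n in sequentially. \<forall>i. R (r n) i \<in> near_profile (k i) (c i) (\<alpha> i) d \<and>
      mu_inf_o (R (r n) i) (r n i) < d \<and> N < length (r n i)"
    if "convergence_testing_tuple k c \<alpha> r" "d > 0" for r d N
    unfolding R_def
  proof (intro eventually_all_finite eventually_conj)
    fix i
    have ct: "convergence_testing (k i) (c i) (\<alpha> i) (\<lambda>n. r n i)"
      using that(1) by (simp add: convergence_testing_tuple_def)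
    show "\<forall>\<^sub>F n in sequentially. map (nearest (c i ` {1..k i})) (r n i) \<in> near_profile (k i) (c i) (\<alpha> i) d"
      by (rule convergence_testing_nearest_near_profile[OF ct k inj c that(2)])
    show "\<forall>\<^sub>F n in sequentially. mu_inf_o (map (nearest (c i ` {1..k i})) (r n i)) (r n i) < d"
      by (rule convergence_testing_nearest(1)[OF ct k inj c that(2)])
    show "\<forall>\<^sub>F n in sequentially. N < length (r n i)"
      by (rule convergence_testing_length[OF ct])
  qed
  have eventually_mu: "\<forall>\<^sub>F n in sequentially. mu_1_u_tuple (R (p n)) (R (q n)) < d" if "d > 0" for d
    unfolding mu_1_u_tuple_less_iff R_def
  proof (intro eventually_all_finite)
    fix i
    show "\<forall>\<^sub>F n in sequentially. mu_1_u (map (nearest (c i ` {1..k i})) (p n i))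
        (map (nearest (c i ` {1..k i})) (q n i)) < d"
      using p q by (intro convergence_testing_nearest_mu_1_u[OF _ _ k inj c that])
        (auto simp: convergence_testing_tuple_def)
  qed
  show "(\<lambda>n. \<bar>F (p n) - F (q n)\<bar>) \<longlonglongrightarrow> 0"
  proof (rule tendstoI)
    fix \<epsilon> :: real assume "\<epsilon> > 0"
    then have \<epsilon>: "\<epsilon> / 3 > 0" by simp
    obtain \<delta>\<^sub>0 where \<delta>\<^sub>0: "\<delta>\<^sub>0 > 0" "\<And>\<delta>. 0 < \<delta> \<Longrightarrow> \<delta> < \<delta>\<^sub>0 \<Longrightarrow>
        asymp_uniformly_continuous_on {p. \<forall>i. p i \<in> near_profile (k i) (c i) (\<alpha> i) \<delta>} F"
      using up unfolding up_continuous_def by blast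
    define \<delta>\<^sub>1 where "\<delta>\<^sub>1 = \<delta>\<^sub>0 / 2"
    have \<delta>\<^sub>1: "\<delta>\<^sub>1 > 0" "\<delta>\<^sub>1 < \<delta>\<^sub>0"
      using \<delta>\<^sub>0 by (auto simp: \<delta>\<^sub>1_def)
    define X where "X = {p. \<forall>i. p i \<in> near_profile (k i) (c i) (\<alpha> i) \<delta>\<^sub>1}"
    obtain n\<^sub>1 \<eta> where \<eta>: "\<eta> > 0" and auc: "\<forall>p\<in>X. \<forall>q\<in>X.
        (\<forall>i. length (p i) \<ge> n\<^sub>1 \<and> length (q i) \<ge> n\<^sub>1) \<longrightarrow> mu_1_u_tuple p q < \<eta> \<longrightarrow>
        \<bar>F p - F q\<bar> < \<epsilon> / 3"
      using \<delta>\<^sub>0(2)[OF \<delta>\<^sub>1, folded X_def, unfolded asymp_uniformly_continuous_on_def, rule_format, OF \<epsilon>]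
      by (elim exE conjE) (rule that)
    obtain \<delta>\<^sub>2 n\<^sub>2 where \<delta>\<^sub>2: "\<delta>\<^sub>2 > 0" and close: "\<forall>p q.
        (\<forall>i. p i \<in> unit_seqs \<and> q i \<in> unit_seqs \<and> length (p i) = length (q i) \<and>
          length (p i) > n\<^sub>2 \<and> mu_inf_o (p i) (q i) < \<delta>\<^sub>2 \<and>
          p i \<in> near_profile (k i) (c i) (\<alpha> i) \<delta>\<^sub>2) \<longrightarrow> \<bar>F p - F q\<bar> < \<epsilon> / 3"
      using up[unfolded up_continuous_def, THEN conjunct2, rule_format, OF \<epsilon>]
      by (elim exE conjE) (rule that)
    \<comment> \<open>The rounded tuple takes the first place in clause (2), since that clause
      demands exact parameter values of its first tuple.\<close>
    have near: "\<forall>\<^sub>F n in sequentially. \<bar>F (R (r n)) - F (r n)\<bar> < \<epsilon> / 3"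
      if r: "convergence_testing_tuple k c \<alpha> r" for r
      using eventually_R[OF r \<delta>\<^sub>2, of n\<^sub>2]
    proof eventually_elim
      case (elim n)
      have "r n i \<in> unit_seqs" "length (R (r n) i) = length (r n i)" for i
        using r convergence_testing_unit[of "k i" "c i" "\<alpha> i" "\<lambda>n. r n i"]
        by (auto simp: convergence_testing_tuple_def R_def)
      with elim show ?case
        by (intro close[rule_format]) (auto simp: near_profile_def)
    qed
    show "\<forall>\<^sub>F n in sequentially. dist \<bar>F (p n) - F (q n)\<bar> 0 < \<epsilon>"
      using near[OF p] near[OF q] eventually_R[OF p \<delta>\<^sub>1(1), of n\<^sub>1] eventually_R[OF q \<delta>\<^sub>1(1), of n\<^sub>1]
        eventually_mu[OF \<eta>]
    proof eventually_elim
      case (elim n)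
      have "\<bar>F (R (p n)) - F (R (q n))\<bar> < \<epsilon> / 3"
        using elim(3-5) by (intro auc[rule_format]) (auto simp: X_def R_def less_imp_le)
      then show ?case
        using elim(1,2) unfolding dist_real_def by linarith
    qed
  qed
qed

section \<open>From ct-continuity to up-continuity\<close>

text \<open>The hypothesis allows distance exactly \<delta> from \<alpha>, because a limit of
  frequencies within \<delta> of \<alpha> may lie on the boundary.\<close>

lemma ct_continuous_imp_asymp_uniformly_continuous_on:
  fixes F :: "('m::finite \<Rightarrow> real list) \<Rightarrow> real"
  assumes ct: "\<And>\<alpha>'. (\<And>i j. j \<in> {1..k i} \<Longrightarrow> \<bar>\<alpha>' i j - \<alpha> i j\<bar> \<le> \<delta> \<and> \<alpha>' i j \<in> {0..1}) \<Longrightarrow>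
      ct_continuous F k c \<alpha>'"
  shows "asymp_uniformly_continuous_on {p. \<forall>i. p i \<in> near_profile (k i) (c i) (\<alpha> i) \<delta>} F"
  unfolding asymp_uniformly_continuous_on_def
proof (intro allI impI, rule ccontr)
  fix \<epsilon> :: real
  define X where "X = {p. \<forall>i. p i \<in> near_profile (k i) (c i) (\<alpha> i) \<delta>}"
  define Q where "Q n d p q \<longleftrightarrow> (\<forall>i. length (p i) \<ge> n \<and> length (q i) \<ge> n) \<longrightarrow>
      mu_1_u_tuple p q < d \<longrightarrow> \<bar>F p - F q\<bar> < \<epsilon>" for n d p q
  assume \<epsilon>: "\<epsilon> > 0"
    and "\<not> (\<exists>n. \<exists>d>0. \<forall>p\<in>{p. \<forall>i. p i \<in> near_profile (k i) (c i) (\<alpha> i) \<delta>}.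
      \<forall>q\<in>{p. \<forall>i. p i \<in> near_profile (k i) (c i) (\<alpha> i) \<delta>}.
        (\<forall>i. length (p i) \<ge> n \<and> length (q i) \<ge> n) \<longrightarrow> mu_1_u_tuple p q < d \<longrightarrow> \<bar>F p - F q\<bar> < \<epsilon>)"
  then have "\<not> (\<exists>n. \<exists>d>0. \<forall>p\<in>X. \<forall>q\<in>X. Q n d p q)"
    by (simp only: X_def Q_def not_False_eq_True)
  \<comment> \<open>The same \<open>n\<close> bounds the lengths from below and sets the tolerance
    \<open>1 / real (Suc n)\<close>, so the counterexamples form two sequences with lengths tending
    to infinity and \<open>mu_1_u\<close> distance tending to 0.\<close>
  then have "\<exists>p\<in>X. \<exists>q\<in>X. \<not> Q n (1 / real (Suc n)) p q" for n
    by (meson of_nat_0_less_iff zero_less_Suc zero_less_divide_1_iff)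
  then have "\<forall>n. \<exists>p q. p \<in> X \<and> q \<in> X \<and> \<not> Q n (1 / real (Suc n)) p q"
    by blast
  then obtain p q where pq: "\<And>n. p n \<in> X" "\<And>n. q n \<in> X" "\<And>n. \<not> Q n (1 / real (Suc n)) (p n) (q n)"
    by metis
  have p: "\<And>n i. p n i \<in> near_profile (k i) (c i) (\<alpha> i) \<delta>"
    and q: "\<And>n i. q n i \<in> near_profile (k i) (c i) (\<alpha> i) \<delta>"
    using pq(1,2) by (auto simp: X_def)
  have len: "\<And>n i. length (p n i) \<ge> n" "\<And>n i. length (q n i) \<ge> n"
    and mu: "\<And>n. mu_1_u_tuple (p n) (q n) < 1 / real (Suc n)"
    and far: "\<And>n. \<not> \<bar>F (p n) - F (q n)\<bar> < \<epsilon>"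
    using pq(3) unfolding Q_def not_imp by blast+
  \<comment> \<open>All pairs of a component and a parameter index are treated as one finite family,
    so that one subsequence serves every frequency.\<close>
  define f where "f a n = freq (p n (fst a)) (c (fst a) (snd a))" for a n
  have "\<exists>s. strict_mono s \<and> (\<forall>a\<in>(SIGMA i:UNIV. {1..k i}). \<exists>l. (f a \<circ> s) \<longlonglongrightarrow> l)"
    using freq_in_unit by (intro simultaneous_convergent_subseq) (auto simp: f_def)
  then obtain s where s: "strict_mono s"
    and "\<forall>a\<in>(SIGMA i:UNIV. {1..k i}). \<exists>l. (f a \<circ> s) \<longlonglongrightarrow> l" by blast
  then obtain l where l: "\<And>a. a \<in> (SIGMA i:UNIV. {1..k i}) \<Longrightarrow> (f a \<circ> s) \<longlonglongrightarrow> l a"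
    by metis
  define \<alpha>' where "\<alpha>' i j = l (i, j)" for i j
  have lim_p: "(\<lambda>n. freq (p (s n) i) (c i j)) \<longlonglongrightarrow> \<alpha>' i j" if "j \<in> {1..k i}" for i j
    using l[of "(i, j)"] that by (simp add: f_def \<alpha>'_def o_def)
  have "\<bar>\<alpha>' i j - \<alpha> i j\<bar> \<le> \<delta> \<and> \<alpha>' i j \<in> {0..1}" if j: "j \<in> {1..k i}" for i j
  proof -
    have "\<bar>freq (p (s n) i) (c i j) - \<alpha> i j\<bar> \<le> \<delta>" for n
      using p[of "s n" i] j by (simp add: near_profile_iff_freq)
    then have "\<bar>\<alpha>' i j - \<alpha> i j\<bar> \<le> \<delta>"
      by (intro LIMSEQ_le_const2[OF tendsto_rabs[OF tendsto_diff[OF lim_p[OF j] tendsto_const]]]) blast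
    moreover have "\<alpha>' i j \<in> {0..1}"
      using closed_sequentially[OF closed_atLeastAtMost _ lim_p[OF j]] freq_in_unit by blast
    ultimately show ?thesis by blast
  qed
  then have ct': "ct_continuous F k c \<alpha>'"
    by (rule ct)
  \<comment> \<open>The subsequence was chosen for \<open>p\<close> alone. The frequencies of
    \<open>q\<close> inherit the limit, since for parameters with a positive gap a vanishing
    \<open>mu_1_u\<close> distance forces the frequencies together.\<close>
  have lim_q: "(\<lambda>n. freq (q (s n) i) (c i j)) \<longlonglongrightarrow> \<alpha>' i j" if j: "j \<in> {1..k i}" for i j
  proof -
    obtain g where g: "g > 0"
      "\<And>x y. x \<in> c i ` {1..k i} \<Longrightarrow> y \<in> c i ` {1..k i} \<Longrightarrow> x \<noteq> y \<Longrightarrow> g \<le> \<bar>x - y\<bar>"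
      using finite_real_set_gap[of "c i ` {1..k i}"] by auto
    have bound: "norm (freq (q n i) (c i j) - freq (p n i) (c i j)) \<le> 2 / g * (1 / real (Suc n))" for n
    proof -
      have "\<bar>freq (p n i) (c i j) - freq (q n i) (c i j)\<bar> \<le> 2 / g * mu_1_u (p n i) (q n i)"
        using p[of n i] q[of n i] j
        by (intro freq_diff_le_mu_1_u[OF _ _ _ _ _ g]) (auto simp: near_profile_def)
      also have "\<dots> \<le> 2 / g * (1 / real (Suc n))"
        using mu[of n] g(1) by (intro mult_left_mono less_imp_le) (auto simp: mu_1_u_tuple_less_iff)
      finally show ?thesis by (simp add: abs_minus_commute)
    qed
    have "(\<lambda>n. 2 / g * (1 / real (Suc n))) \<longlonglongrightarrow> 2 / g * 0"
      by (intro tendsto_mult tendsto_const LIMSEQ_Suc lim_1_over_n)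
    then have "(\<lambda>n. freq (q n i) (c i j) - freq (p n i) (c i j)) \<longlonglongrightarrow> 0"
      by (intro Lim_null_comparison[OF always_eventually[OF allI[OF bound]]]) simp
    from tendsto_add[OF LIMSEQ_subseq_LIMSEQ[OF this s] lim_p[OF j]] show ?thesis
      by (simp add: o_def)
  qed
  have "\<exists>n. \<bar>F (p (s n)) - F (q (s n))\<bar> < \<epsilon>"
  proof (rule ct_continuous_approx_profile[OF ct' \<epsilon>])
    show "approx_profile (k i) (c i) (\<alpha>' i) (\<lambda>n. p (s n) i)" for i
      using p lim_p by (intro approx_profile_self) (auto simp: near_profile_def)
    show "approx_profile (k i) (c i) (\<alpha>' i) (\<lambda>n. q (s n) i)" for i
      using q lim_q by (intro approx_profile_self) (auto simp: near_profile_def)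
    show "n \<le> length (p (s n) i)" "n \<le> length (q (s n) i)" for i n
      using seq_suble[OF s, of n] len[of "s n" i] by linarith+
  qed
  then show False
    using far by blast
qed

text \<open>In a sequence of counterexamples the profile width shrinks together with the distance,
  so the frequencies of \<open>p\<close> tend to \<alpha> itself. Thus no subsequence has to be
  chosen for them, and ct-continuity at \<alpha> suffices.\<close>

lemma ct_continuous_imp_close:
  fixes F :: "('m::finite \<Rightarrow> real list) \<Rightarrow> real"
  assumes ct: "ct_continuous F k c \<alpha>" and \<epsilon>: "\<epsilon> > 0"
  shows "\<exists>\<delta>>0. \<exists>n\<^sub>0. \<forall>p q.
        (\<forall>i. p i \<in> unit_seqs \<and> q i \<in> unit_seqs \<and>
             length (p i) = length (q i) \<and> length (p i) > n\<^sub>0 \<and>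
             mu_inf_o (p i) (q i) < \<delta> \<and>
             p i \<in> near_profile (k i) (c i) (\<alpha> i) \<delta>) \<longrightarrow>
        \<bar>F p - F q\<bar> < \<epsilon>"
proof (rule ccontr)
  define P where "P d n p q \<longleftrightarrow> (\<forall>i. p i \<in> unit_seqs \<and> q i \<in> unit_seqs \<and>
      length (p i) = length (q i) \<and> length (p i) > n \<and> mu_inf_o (p i) (q i) < d \<and>
      p i \<in> near_profile (k i) (c i) (\<alpha> i) d)" for d n p q
  assume "\<not> ?thesis"
  then have "\<not> (\<exists>d>0. \<exists>n. \<forall>p q. P d n p q \<longrightarrow> \<bar>F p - F q\<bar> < \<epsilon>)"
    by (simp only: P_def not_False_eq_True)
  then have "\<exists>p q. P (1 / real (Suc n)) n p q \<and> \<not> \<bar>F p - F q\<bar> < \<epsilon>" for n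
    by (meson of_nat_0_less_iff zero_less_Suc zero_less_divide_1_iff)
  then obtain p q where P: "\<And>n. P (1 / real (Suc n)) n (p n) (q n)" and
    far: "\<And>n. \<not> \<bar>F (p n) - F (q n)\<bar> < \<epsilon>"
    by metis
  have pq: "p n i \<in> unit_seqs" "q n i \<in> unit_seqs" "length (p n i) = length (q n i)"
    "length (p n i) > n" "mu_inf_o (p n i) (q n i) < 1 / real (Suc n)"
    "p n i \<in> near_profile (k i) (c i) (\<alpha> i) (1 / real (Suc n))" for n i
    using P[of n] unfolding P_def by blast+
  have null: "(\<lambda>n. 1 / real (Suc n)) \<longlonglongrightarrow> 0"
    by (intro LIMSEQ_Suc lim_1_over_n)
  have lim: "(\<lambda>n. freq (p n i) (c i j)) \<longlonglongrightarrow> \<alpha> i j" if j: "j \<in> {1..k i}" for i j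
  proof -
    have "norm (freq (p n i) (c i j) - \<alpha> i j) \<le> 1 / real (Suc n)" for n
      using pq(6)[of n i] j by (simp add: near_profile_iff_freq)
    then have "(\<lambda>n. freq (p n i) (c i j) - \<alpha> i j) \<longlonglongrightarrow> 0"
      by (intro Lim_null_comparison[OF always_eventually null]) blast
    then show ?thesis
      by (rule LIM_zero_cancel)
  qed
  have "\<exists>n. \<bar>F (p n) - F (q n)\<bar> < \<epsilon>"
  proof (rule ct_continuous_approx_profile[OF ct \<epsilon>])
    show "approx_profile (k i) (c i) (\<alpha> i) (\<lambda>n. p n i)" for i
      using pq(1,6) lim by (intro approx_profile_self) (auto simp: near_profile_def)
    \<comment> \<open>The entries of \<open>q\<close> need not be parameters; the tuple
      \<open>p\<close> serves as the exact profile, with entrywise error controlled by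
      \<open>mu_inf_o\<close>.\<close>
    show "approx_profile (k i) (c i) (\<alpha> i) (\<lambda>n. q n i)" for i
      unfolding approx_profile_def
    proof (intro conjI allI exI[of _ "\<lambda>n. p n i"] exI[of _ "\<lambda>n. 1 / real (Suc n)"] impI ballI)
      fix n j assume "j < length (q n i)"
      then have "\<bar>p n i ! j - q n i ! j\<bar> \<le> mu_inf_o (p n i) (q n i)"
        using pq(1,2,3) by (intro nth_diff_le_mu_inf_o) auto
      then show "\<bar>q n i ! j - p n i ! j\<bar> \<le> 1 / real (Suc n)"
        using pq(5)[of n i] by (simp add: abs_minus_commute)
    next
      show "set (p n i) \<subseteq> c i ` {1..k i}" for n
        using pq(6)[of n i] by (simp add: near_profile_def)
    qed (use pq null lim in auto)
    show "n \<le> length (p n i)" "n \<le> length (q n i)" for i n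
      using pq(3)[of n i] pq(4)[of n i] by linarith+
  qed
  then show False
    using far by blast
qed

text \<open>For every width \<open>d\<close> below \<delta>, the closed
  \<open>d\<close>-neighbourhood of \<alpha> lies in the open \<delta>-neighbourhood, which yields
  clause (1). Clause (2) uses the choice of \<alpha> itself for \<open>\<alpha>'\<close>.\<close>

lemma ct_continuous_imp_up_continuous:
  fixes F :: "('m::finite \<Rightarrow> real list) \<Rightarrow> real"
  assumes "\<delta> > 0" and \<alpha>: "\<And>i j. j \<in> {1..k i} \<Longrightarrow> \<alpha> i j \<in> {0..1}"
    and ct: "\<And>\<alpha>'. (\<And>i j. j \<in> {1..k i} \<Longrightarrow> \<alpha>' i j \<in> {\<alpha> i j - \<delta><..<\<alpha> i j + \<delta>} \<inter> {0..1}) \<Longrightarrow>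
      ct_continuous F k c \<alpha>'"
  shows "up_continuous F k c \<alpha>"
  unfolding up_continuous_def
proof (rule conjI)
  have "asymp_uniformly_continuous_on {p. \<forall>i. p i \<in> near_profile (k i) (c i) (\<alpha> i) d} F"
    if d: "0 < d \<and> d < \<delta>" for d
  proof (rule ct_continuous_imp_asymp_uniformly_continuous_on, rule ct)
    fix \<alpha>' i j
    assume "\<And>i j. j \<in> {1..k i} \<Longrightarrow> \<bar>\<alpha>' i j - \<alpha> i j\<bar> \<le> d \<and> \<alpha>' i j \<in> {0..1}" "j \<in> {1..k i}"
    then have "\<bar>\<alpha>' i j - \<alpha> i j\<bar> \<le> d \<and> \<alpha>' i j \<in> {0..1}"
      by blast
    then show "\<alpha>' i j \<in> {\<alpha> i j - \<delta><..<\<alpha> i j + \<delta>} \<inter> {0..1}"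
      using d by (auto simp: abs_le_iff)
  qed
  then show "\<exists>\<delta>\<^sub>0>0. \<forall>d. 0 < d \<and> d < \<delta>\<^sub>0 \<longrightarrow>
      asymp_uniformly_continuous_on {p. \<forall>i. p i \<in> near_profile (k i) (c i) (\<alpha> i) d} F"
    using assms(1) by blast
  have "ct_continuous F k c \<alpha>"
    using assms(1) \<alpha> by (intro ct) auto
  then show "\<forall>\<epsilon>>0. \<exists>\<delta>>0. \<exists>n\<^sub>0. \<forall>p q. (\<forall>i. p i \<in> unit_seqs \<and> q i \<in> unit_seqs \<and>
      length (p i) = length (q i) \<and> length (p i) > n\<^sub>0 \<and> mu_inf_o (p i) (q i) < \<delta> \<and>
      p i \<in> near_profile (k i) (c i) (\<alpha> i) \<delta>) \<longrightarrow> \<bar>F p - F q\<bar> < \<epsilon>"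
    using ct_continuous_imp_close by (intro allI impI)
qed

text \<open>The parameters are distinct in the first half because a repeated parameter admits no
  disjoint family of intervals: the corresponding component of a convergence testing tuple could
  then be any sequence in \<open>unit_seqs\<close> with strictly increasing lengths.\<close>

theorem proposition4p10:
  fixes F :: "('m::finite \<Rightarrow> real list) \<Rightarrow> real"
    and k :: "'m \<Rightarrow> nat"
    and c \<alpha> :: "'m \<Rightarrow> nat \<Rightarrow> real"
  assumes "aggregation_function F"
    and "\<forall>i. k i \<ge> 1"
    and "\<forall>i. \<forall>j\<in>{1..k i}. c i j \<in> {0..1} \<and> \<alpha> i j \<in> {0..1}"
  shows "((\<forall>i. inj_on (c i) {1..k i}) \<longrightarrow> up_continuous F k c \<alpha> \<longrightarrow> ct_continuous F k c \<alpha>) \<and>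
         ((\<exists>\<delta>>0. \<forall>\<alpha>' :: 'm \<Rightarrow> nat \<Rightarrow> real.
             (\<forall>i. \<forall>j\<in>{1..k i}. \<alpha>' i j \<in> {\<alpha> i j - \<delta><..<\<alpha> i j + \<delta>} \<inter> {0..1}) \<longrightarrow>
             ct_continuous F k c \<alpha>') \<longrightarrow>
          up_continuous F k c \<alpha>)"
proof (intro conjI impI)
  assume "\<forall>i. inj_on (c i) {1..k i}" "up_continuous F k c \<alpha>"
  then show "ct_continuous F k c \<alpha>"
    using assms by (intro up_continuous_imp_ct_continuous) auto
next
  assume "\<exists>\<delta>>0. \<forall>\<alpha>' :: 'm \<Rightarrow> nat \<Rightarrow> real.
             (\<forall>i. \<forall>j\<in>{1..k i}. \<alpha>' i j \<in> {\<alpha> i j - \<delta><..<\<alpha> i j + \<delta>} \<inter> {0..1}) \<longrightarrow>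
             ct_continuous F k c \<alpha>'"
  then obtain \<delta> where "\<delta> > 0" and ct: "\<And>\<alpha>'. \<forall>i. \<forall>j\<in>{1..k i}. \<alpha>' i j \<in> {\<alpha> i j - \<delta><..<\<alpha> i j + \<delta>} \<inter> {0..1} \<Longrightarrow>
      ct_continuous F k c \<alpha>'" by blast
  then show "up_continuous F k c \<alpha>"
    using assms(3) by (intro ct_continuous_imp_up_continuous[OF \<open>\<delta> > 0\<close> _ ct]) blast+
qed

end
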